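(* The disjunction and existence properties hold in $LJ^+$ in application to unipolar formulas. That is: (i) if $A\lor B$ is a unipolar formula derivable in $LJ^+$, then $A$ is derivable in $LJ^+$ or $B$ is derivable in $LJ^+$; (ii) if $\exists x\,A(x)$ is a unipolar formula derivable in $LJ^+$, then $A(t)$ is derivable in $LJ^+$ for some variable $t$.
   Context: Formulas are first-order formulas without function symbols and without object constants (so the only terms are variables), built from propositional symbols (relation symbols of arity $0$), predicate symbols (relation symbols of arity at least $1$), the logical constants $\top,\bot$, the connectives $\&,\lor,\neg,\supset$ and the quantifiers $\forall,\exists$; quantified formulas $\forall x\,F(x)$, $\exists x\,F(x)$ are formed only from $F(x)$ in which $x$ occurs free. $\top,\bot$ are not counted as propositional or predicate symbols. A formula is propositional if it contains only propositional symbols (no predicate symbols). Positive and negative subformula occurrences in a formula $A$ are defined recursively: $A$ itself is positive; if $B\lor C$ or $B\&C$ is positive (negative), then $B$ and $C$ are positive (negative); if $\neg B$ is positive (negative), then $B$ is negative (positive); if $B\supset C$ is positive (negative), then $B$ is negative (positive) and $C$ is positive (negative); if $\forall x\,B(x)$ or $\exists x\,B(x)$ is positive (negative), then $B(x)$ is positive (negative). A formula is unipolar if for every propositional symbol, its occurrences in the formula are either all positive or all negative. A sequent is $\Gamma\vdash\Lambda$ with $\Gamma$ a finite, possibly empty sequence of formulas and $\Lambda$ either a single formula or empty. The calculus $LJ$ (Gentzen's intuitionistic sequent calculus) has axioms $A\vdash A$ (any formula $A$), $\vdash\top$, $\bot\vdash$, and the following rules (premises / conclusion). Thinning: $\Gamma\vdash\Lambda\,/\,A,\Gamma\vdash\Lambda$;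 $\Gamma\vdash\,/\,\Gamma\vdash A$. Contraction: $A,A,\Gamma\vdash\Lambda\,/\,A,\Gamma\vdash\Lambda$. Exchange: $\Pi,A,B,\Gamma\vdash\Lambda\,/\,\Pi,B,A,\Gamma\vdash\Lambda$. Cut: $\Gamma\vdash C$ and $C,\Pi\vdash\Lambda\,/\,\Gamma,\Pi\vdash\Lambda$. $\&$: $\Gamma\vdash A$ and $\Gamma\vdash B\,/\,\Gamma\vdash A\&B$; $A,\Gamma\vdash\Lambda\,/\,A\&B,\Gamma\vdash\Lambda$; $B,\Gamma\vdash\Lambda\,/\,A\&B,\Gamma\vdash\Lambda$. $\lor$: $A,\Gamma\vdash\Lambda$ and $B,\Gamma\vdash\Lambda\,/\,A\lor B,\Gamma\vdash\Lambda$; $\Gamma\vdash A\,/\,\Gamma\vdash A\lor B$; $\Gamma\vdash B\,/\,\Gamma\vdash A\lor B$. $\neg$: $A,\Gamma\vdash\,/\,\Gamma\vdash\neg A$; $\Gamma\vdash A\,/\,\neg A,\Gamma\vdash$. $\supset$: $A,\Gamma\vdash B\,/\,\Gamma\vdash A\supset B$; $\Gamma\vdash A$ and $B,\Pi\vdash\Lambda\,/\,A\supset B,\Gamma,\Pi\vdash\Lambda$. $\forall$: $\Gamma\vdash F(a)\,/\,\Gamma\vdash\forall x\,F(x)$; $F(a),\Gamma\vdash\Lambda\,/\,\forall x\,F(x),\Gamma\vdash\Lambda$. $\exists$: $\Gamma\vdash F(a)\,/\,\Gamma\vdash\exists x\,F(x)$; $F(a),\Gamma\vdash\Lambda\,/\,\exists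 x\,F(x),\Gamma\vdash\Lambda$. Here $a$ is a variable and $F(a)$ is the result of (capture-free) substitution of $a$ for $x$ in $F(x)$; in the $\forall$-succedent and $\exists$-antecedent rules $a$ (the eigenvariable) must not occur in the conclusion. $LJ^+$ is $LJ$ extended with the neutralization rule: $N,\Gamma\vdash\Lambda$ and $\neg N,\Gamma\vdash\Lambda\,/\,\Gamma\vdash\Lambda$, where $N$ must be a propositional formula. A formula $A$ is derivable in a calculus if the sequent $\vdash A$ is. *)

theory Defs
  imports Main
begin

type_synonym var = nat

text \<open>
  The relation symbols are the elements of an arbitrary type \<open>'s\<close>; a function \<open>ar\<close>,
  a parameter of all notions below, gives their arities.  Those of arity 0 are the
  propositional symbols, the others are the predicate symbols.
\<close>

datatype (symbols: 's) fm =
    Atom 's "var list"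
  | Truth
  | Falsum
  | Conj "'s fm" "'s fm"
  | Disj "'s fm" "'s fm"
  | Neg "'s fm"
  | Imp "'s fm" "'s fm"
  | Forall var "'s fm"
  | Exists var "'s fm"

primrec free_vars :: "'s fm \<Rightarrow> var set" where
  "free_vars (Atom p ts) = set ts"
| "free_vars Truth = {}"
| "free_vars Falsum = {}"
| "free_vars (Conj A B) = free_vars A \<union> free_vars B"
| "free_vars (Disj A B) = free_vars A \<union> free_vars B"
| "free_vars (Neg A) = free_vars A"
| "free_vars (Imp A B) = free_vars A \<union> free_vars B"
| "free_vars (Forall x F) = free_vars F - {x}"
| "free_vars (Exists x F) = free_vars F - {x}"

text \<open>All variables occurring in a formula, be it free, bound or next to a quantifier.\<close>

primrec vars :: "'s fm \<Rightarrow> var set" where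
  "vars (Atom p ts) = set ts"
| "vars Truth = {}"
| "vars Falsum = {}"
| "vars (Conj A B) = vars A \<union> vars B"
| "vars (Disj A B) = vars A \<union> vars B"
| "vars (Neg A) = vars A"
| "vars (Imp A B) = vars A \<union> vars B"
| "vars (Forall x F) = insert x (vars F)"
| "vars (Exists x F) = insert x (vars F)"

primrec is_formula :: "('s \<Rightarrow> nat) \<Rightarrow> 's fm \<Rightarrow> bool" where
  "is_formula ar (Atom p ts) \<longleftrightarrow> length ts = ar p"
| "is_formula ar Truth \<longleftrightarrow> True"
| "is_formula ar Falsum \<longleftrightarrow> True"
| "is_formula ar (Conj A B) \<longleftrightarrow> is_formula ar A \<and> is_formula ar B"
| "is_formula ar (Disj A B) \<longleftrightarrow> is_formula ar A \<and> is_formula ar B"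
| "is_formula ar (Neg A) \<longleftrightarrow> is_formula ar A"
| "is_formula ar (Imp A B) \<longleftrightarrow> is_formula ar A \<and> is_formula ar B"
| "is_formula ar (Forall x F) \<longleftrightarrow> is_formula ar F \<and> x \<in> free_vars F"
| "is_formula ar (Exists x F) \<longleftrightarrow> is_formula ar F \<and> x \<in> free_vars F"

text \<open>
  Simultaneous capture-free substitution.  A bound variable \<open>x\<close> is renamed only if it
  would capture a variable substituted for one of the free variables of the
  quantified formula, whose images form the set \<open>V\<close> below.
\<close>

definition rename_bound :: "var \<Rightarrow> var set \<Rightarrow> var" where
  "rename_bound x V = (if x \<notin> V then x else (LEAST y. y \<notin> V))"

primrec ssubst :: "(var \<Rightarrow> var) \<Rightarrow> 's fm \<Rightarrow> 's fm" where
  "ssubst \<sigma> (Atom p ts) = Atom p (map \<sigma> ts)"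
| "ssubst \<sigma> Truth = Truth"
| "ssubst \<sigma> Falsum = Falsum"
| "ssubst \<sigma> (Conj A B) = Conj (ssubst \<sigma> A) (ssubst \<sigma> B)"
| "ssubst \<sigma> (Disj A B) = Disj (ssubst \<sigma> A) (ssubst \<sigma> B)"
| "ssubst \<sigma> (Neg A) = Neg (ssubst \<sigma> A)"
| "ssubst \<sigma> (Imp A B) = Imp (ssubst \<sigma> A) (ssubst \<sigma> B)"
| "ssubst \<sigma> (Forall x F) =
    (let y = rename_bound x (\<sigma> ` (free_vars F - {x})) in Forall y (ssubst (\<sigma>(x := y)) F))"
| "ssubst \<sigma> (Exists x F) =
    (let y = rename_bound x (\<sigma> ` (free_vars F - {x})) in Exists y (ssubst (\<sigma>(x := y)) F))"

definition subst :: "'s fm \<Rightarrow> var \<Rightarrow> var \<Rightarrow> 's fm" where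
  "subst F x a = ssubst (id(x := a)) F"

definition propositional :: "('s \<Rightarrow> nat) \<Rightarrow> 's fm \<Rightarrow> bool" where
  "propositional ar A \<longleftrightarrow> is_formula ar A \<and> (\<forall>p \<in> symbols A. ar p = 0)"

text \<open>
  \<open>occurs A s B\<close>: the formula \<open>B\<close> has a positive (\<open>s = True\<close>) or negative
  (\<open>s = False\<close>) subformula occurrence in \<open>A\<close>.
\<close>

inductive occurs :: "'s fm \<Rightarrow> bool \<Rightarrow> 's fm \<Rightarrow> bool" for A :: "'s fm" where
  self: "occurs A True A"
| disj1: "occurs A s (Disj B C) \<Longrightarrow> occurs A s B"
| disj2: "occurs A s (Disj B C) \<Longrightarrow> occurs A s C"
| conj1: "occurs A s (Conj B C) \<Longrightarrow> occurs A s B"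
| conj2: "occurs A s (Conj B C) \<Longrightarrow> occurs A s C"
| neg: "occurs A s (Neg B) \<Longrightarrow> occurs A (\<not> s) B"
| imp1: "occurs A s (Imp B C) \<Longrightarrow> occurs A (\<not> s) B"
| imp2: "occurs A s (Imp B C) \<Longrightarrow> occurs A s C"
| forall: "occurs A s (Forall x B) \<Longrightarrow> occurs A s B"
| exists: "occurs A s (Exists x B) \<Longrightarrow> occurs A s B"

definition unipolar :: "('s \<Rightarrow> nat) \<Rightarrow> 's fm \<Rightarrow> bool" where
  "unipolar ar A \<longleftrightarrow>
    (\<forall>p. ar p = 0 \<longrightarrow>
      (\<forall>s. occurs A s (Atom p []) \<longrightarrow> s = True) \<or>
      (\<forall>s. occurs A s (Atom p []) \<longrightarrow> s = False))"

text \<open>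
  The calculus \<open>LJ\<^sup>+\<close>; the rule \<open>neutralization\<close> is what it adds to \<open>LJ\<close>.
  The side conditions \<open>is_formula\<close> are imposed where a rule brings in an expression that
  is not already in its premises; lemma \<open>LJp_is_formula\<close> below shows that this suffices.
\<close>

inductive LJp :: "('s \<Rightarrow> nat) \<Rightarrow> 's fm list \<Rightarrow> 's fm option \<Rightarrow> bool"
  for ar :: "'s \<Rightarrow> nat" where
  axiom: "is_formula ar A \<Longrightarrow> LJp ar [A] (Some A)"
| truth: "LJp ar [] (Some Truth)"
| falsum: "LJp ar [Falsum] None"
| thin_left: "LJp ar \<Gamma> \<Lambda> \<Longrightarrow> is_formula ar A \<Longrightarrow> LJp ar (A # \<Gamma>) \<Lambda>"
| thin_right: "LJp ar \<Gamma> None \<Longrightarrow> is_formula ar A \<Longrightarrow> LJp ar \<Gamma> (Some A)"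
| contraction: "LJp ar (A # A # \<Gamma>) \<Lambda> \<Longrightarrow> LJp ar (A # \<Gamma>) \<Lambda>"
| exchange: "LJp ar (\<Pi> @ A # B # \<Gamma>) \<Lambda> \<Longrightarrow> LJp ar (\<Pi> @ B # A # \<Gamma>) \<Lambda>"
| cut: "LJp ar \<Gamma> (Some C) \<Longrightarrow> LJp ar (C # \<Pi>) \<Lambda> \<Longrightarrow> LJp ar (\<Gamma> @ \<Pi>) \<Lambda>"
| conj_right: "LJp ar \<Gamma> (Some A) \<Longrightarrow> LJp ar \<Gamma> (Some B) \<Longrightarrow> LJp ar \<Gamma> (Some (Conj A B))"
| conj_left1: "LJp ar (A # \<Gamma>) \<Lambda> \<Longrightarrow> is_formula ar B \<Longrightarrow> LJp ar (Conj A B # \<Gamma>) \<Lambda>"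
| conj_left2: "LJp ar (B # \<Gamma>) \<Lambda> \<Longrightarrow> is_formula ar A \<Longrightarrow> LJp ar (Conj A B # \<Gamma>) \<Lambda>"
| disj_left: "LJp ar (A # \<Gamma>) \<Lambda> \<Longrightarrow> LJp ar (B # \<Gamma>) \<Lambda> \<Longrightarrow> LJp ar (Disj A B # \<Gamma>) \<Lambda>"
| disj_right1: "LJp ar \<Gamma> (Some A) \<Longrightarrow> is_formula ar B \<Longrightarrow> LJp ar \<Gamma> (Some (Disj A B))"
| disj_right2: "LJp ar \<Gamma> (Some B) \<Longrightarrow> is_formula ar A \<Longrightarrow> LJp ar \<Gamma> (Some (Disj A B))"
| neg_right: "LJp ar (A # \<Gamma>) None \<Longrightarrow> LJp ar \<Gamma> (Some (Neg A))"
| neg_left: "LJp ar \<Gamma> (Some A) \<Longrightarrow> LJp ar (Neg A # \<Gamma>) None"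
| imp_right: "LJp ar (A # \<Gamma>) (Some B) \<Longrightarrow> LJp ar \<Gamma> (Some (Imp A B))"
| imp_left: "LJp ar \<Gamma> (Some A) \<Longrightarrow> LJp ar (B # \<Pi>) \<Lambda> \<Longrightarrow> LJp ar (Imp A B # \<Gamma> @ \<Pi>) \<Lambda>"
| forall_right: "LJp ar \<Gamma> (Some (subst F x a)) \<Longrightarrow> is_formula ar (Forall x F) \<Longrightarrow>
    \<forall>C \<in> set \<Gamma>. a \<notin> vars C \<Longrightarrow> a \<notin> vars (Forall x F) \<Longrightarrow>
    LJp ar \<Gamma> (Some (Forall x F))"
| forall_left: "LJp ar (subst F x a # \<Gamma>) \<Lambda> \<Longrightarrow> is_formula ar (Forall x F) \<Longrightarrow>
    LJp ar (Forall x F # \<Gamma>) \<Lambda>"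
| exists_right: "LJp ar \<Gamma> (Some (subst F x a)) \<Longrightarrow> is_formula ar (Exists x F) \<Longrightarrow>
    LJp ar \<Gamma> (Some (Exists x F))"
| exists_left: "LJp ar (subst F x a # \<Gamma>) \<Lambda> \<Longrightarrow> is_formula ar (Exists x F) \<Longrightarrow>
    \<forall>C \<in> set \<Gamma> \<union> set_option \<Lambda>. a \<notin> vars C \<Longrightarrow> a \<notin> vars (Exists x F) \<Longrightarrow>
    LJp ar (Exists x F # \<Gamma>) \<Lambda>"
| neutralization: "LJp ar (N # \<Gamma>) \<Lambda> \<Longrightarrow> LJp ar (Neg N # \<Gamma>) \<Lambda> \<Longrightarrow> propositional ar N \<Longrightarrow>
    LJp ar \<Gamma> \<Lambda>"

definition derivable :: "('s \<Rightarrow> nat) \<Rightarrow> 's fm \<Rightarrow> bool" where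
  "derivable ar A \<longleftrightarrow> LJp ar [] (Some A)"

lemma finite_free_vars: "finite (free_vars A)"
  by (induction A) auto

lemma rename_bound_fresh:
  assumes "finite V"
  shows "rename_bound x V \<notin> V"
proof (cases "x \<in> V")
  case True
  obtain y where "y \<notin> V" using assms by (metis ex_new_if_finite infinite_UNIV_nat)
  then have "(LEAST y. y \<notin> V) \<notin> V" by (rule LeastI)
  with True show ?thesis by (simp add: rename_bound_def)
qed (simp add: rename_bound_def)

lemma image_upd_fresh:
  assumes "y \<notin> \<sigma> ` (V - {x})"
  shows "(\<sigma>(x := y)) ` V - {y} = \<sigma> ` (V - {x})"
  using assms by (force simp: image_iff)

lemma free_vars_ssubst: "free_vars (ssubst \<sigma> A) = \<sigma> ` free_vars A"
proof (induction A arbitrary: \<sigma>)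
  case (Forall x F)
  have "rename_bound x (\<sigma> ` (free_vars F - {x})) \<notin> \<sigma> ` (free_vars F - {x})"
    by (rule rename_bound_fresh) (simp add: finite_free_vars)
  from image_upd_fresh[OF this] show ?case
    by (simp only: ssubst.simps free_vars.simps Let_def Forall)
next
  case (Exists x F)
  have "rename_bound x (\<sigma> ` (free_vars F - {x})) \<notin> \<sigma> ` (free_vars F - {x})"
    by (rule rename_bound_fresh) (simp add: finite_free_vars)
  from image_upd_fresh[OF this] show ?case
    by (simp only: ssubst.simps free_vars.simps Let_def Exists)
qed auto

lemma is_formula_ssubst: "is_formula ar A \<Longrightarrow> is_formula ar (ssubst \<sigma> A)"
  by (induction A arbitrary: \<sigma>) (auto simp: Let_def free_vars_ssubst image_iff)

lemma LJp_is_formula: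
  "LJp ar \<Gamma> \<Lambda> \<Longrightarrow> \<forall>A \<in> set \<Gamma> \<union> set_option \<Lambda>. is_formula ar A"
  by (induction rule: LJp.induct) auto

end

theory Submission
  imports Defs
begin

text \<open>
  Neutralization amounts to deciding every propositional symbol, and a unipolar formula has a
  worst decision: let \<open>v\<close> make a symbol false if it occurs positively in the formula, and true
  otherwise.  Write \<open>psub v A\<close> for \<open>A\<close> with the propositional symbols replaced by \<open>\<top>\<close> and
  \<open>\<bottom>\<close> accordingly.  Two facts about this replacement carry the proof.

  First, for this \<open>v\<close> the replacement only strengthens the formula: positive symbols became
  \<open>\<bottom>\<close> and negative ones \<open>\<top>\<close>, so \<open>psub v A\<close> entails \<open>A\<close>, for \<open>A\<close> and all its positive
  subformulas (\<open>psub_polarity\<close>).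

  Secondly, \<open>psub v\<close> of whatever is derivable satisfies the disjunction and existence
  properties.  This is shown by Aczel's slash, defined relative to derivability of \<open>psub v A\<close>:
  no cut elimination is needed, because the slash is sound for every rule, cut included
  (\<open>slash_sound\<close>).  Neutralization is sound for it as well: after the replacement a propositional
  formula has no symbols left, so either it is slashed or it is refutable
  (\<open>slash_propositional\<close>).

  So if \<open>A \<or> B\<close> is derivable, it is slashed, hence \<open>A\<close> or \<open>B\<close> is, hence \<open>psub v A\<close> or
  \<open>psub v B\<close> is derivable, and by the first fact so is \<open>A\<close> or \<open>B\<close>.  The existential
  quantifier is treated in the same way.

  The slash of open formulas is taken under all renamings of the free variables, so derivations
  must be closed under renaming.  As substitution renames bound variables, composing two
  substitutions gives the expected formula only up to bound variables; the relation
  \<open>variant\<close> handles this, and variants are interderivable (\<open>variant_derivable\<close>).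
\<close>

section \<open>Structural rules and monotonicity of the connectives\<close>

text \<open>
  Rules for backward search.  Contraction, exchange, cut and neutralization would apply again to
  their own premises, \<open>imp_left\<close> has to split the context, and the quantifier rules need a chosen
  variable; these are applied by hand.
\<close>

lemmas LJp_logical =
  LJp.axiom LJp.truth LJp.falsum LJp.thin_left LJp.thin_right LJp.conj_right LJp.conj_left1
  LJp.conj_left2 LJp.disj_left LJp.disj_right1 LJp.disj_right2 LJp.neg_right LJp.neg_left
  LJp.imp_right

lemma LJp_cut_all:
  "LJp ar \<Gamma> \<Lambda> \<Longrightarrow> \<forall>C\<in>set \<Gamma>. LJp ar [] (Some C) \<Longrightarrow> LJp ar [] \<Lambda>"
proof (induction \<Gamma>)
  case (Cons C \<Gamma>)
  then have "LJp ar ([] @ \<Gamma>) \<Lambda>" by (intro LJp.cut[of ar "[]" C]) auto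
  with Cons show ?case by simp
qed

lemma LJp_cut_left: "LJp ar [A] (Some B) \<Longrightarrow> LJp ar (B # \<Gamma>) \<Lambda> \<Longrightarrow> LJp ar (A # \<Gamma>) \<Lambda>"
  using LJp.cut[of ar "[A]" B \<Gamma> \<Lambda>] by simp

lemma LJp_cut_right: "LJp ar \<Gamma> (Some A) \<Longrightarrow> LJp ar [A] (Some B) \<Longrightarrow> LJp ar \<Gamma> (Some B)"
  using LJp.cut[of ar \<Gamma> A "[]" "Some B"] by simp

lemma LJp_formulaD:
  assumes "LJp ar [A] (Some B)"
  shows "is_formula ar A" "is_formula ar B"
  using LJp_is_formula[OF assms] by auto

lemma Conj_mono:
  assumes "LJp ar [A] (Some A')" "LJp ar [B] (Some B')"
  shows "LJp ar [Conj A B] (Some (Conj A' B'))"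
  using assms by (intro LJp.conj_right LJp.conj_left1 LJp.conj_left2 LJp_formulaD)

lemma Disj_mono:
  assumes "LJp ar [A] (Some A')" "LJp ar [B] (Some B')"
  shows "LJp ar [Disj A B] (Some (Disj A' B'))"
  using assms
  by (auto intro!: LJp.disj_left intro: LJp.disj_right1 LJp.disj_right2 LJp_formulaD)

lemma Neg_mono:
  assumes "LJp ar [A'] (Some A)"
  shows "LJp ar [Neg A] (Some (Neg A'))"
proof -
  have "LJp ar ([] @ Neg A # A' # []) None" using LJp.neg_left[OF assms] by simp
  from LJp.exchange[OF this] show ?thesis by (simp add: LJp.neg_right)
qed

lemma Imp_mono:
  assumes "LJp ar [A'] (Some A)" "LJp ar [B] (Some B')"
  shows "LJp ar [Imp A B] (Some (Imp A' B'))"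
proof -
  have "LJp ar ([] @ Imp A B # A' # []) (Some B')" using LJp.imp_left[OF assms] by simp
  from LJp.exchange[OF this] show ?thesis by (simp add: LJp.imp_right)
qed

lemma finite_vars: "finite (vars A)"
  by (induction A) auto

lemma free_vars_subset_vars: "free_vars A \<subseteq> vars A"
  by (induction A) auto

lemma fresh_var:
  obtains a where "\<forall>C\<in>set \<Gamma>. a \<notin> vars C"
proof -
  have "finite (\<Union>C\<in>set \<Gamma>. vars C)" by (simp add: finite_vars)
  then obtain a where "a \<notin> (\<Union>C\<in>set \<Gamma>. vars C)"
    using ex_new_if_finite infinite_UNIV_nat by blast
  with that show thesis by blast
qed

lemma Forall_mono:
  assumes "\<And>a. LJp ar [subst F x a] (Some (subst G y a))"
    and "is_formula ar (Forall x F)" "is_formula ar (Forall y G)"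
  shows "LJp ar [Forall x F] (Some (Forall y G))"
proof -
  obtain a where "\<forall>C\<in>set [Forall x F, Forall y G]. a \<notin> vars C" by (rule fresh_var)
  with LJp.forall_left[OF assms(1,2)] assms(3) show ?thesis
    by (intro LJp.forall_right[where a = a]) auto
qed

lemma Exists_mono:
  assumes "\<And>a. LJp ar [subst F x a] (Some (subst G y a))"
    and "is_formula ar (Exists x F)" "is_formula ar (Exists y G)"
  shows "LJp ar [Exists x F] (Some (Exists y G))"
proof -
  obtain a where "\<forall>C\<in>set [Exists x F, Exists y G]. a \<notin> vars C" by (rule fresh_var)
  with LJp.exists_right[OF assms(1,3)] assms(2) show ?thesis
    by (intro LJp.exists_left[where a = a]) auto
qed

section \<open>Substitution up to renaming of bound variables\<close>

lemma ssubst_cong: "\<forall>z\<in>free_vars A. \<sigma> z = \<tau> z \<Longrightarrow> ssubst \<sigma> A = ssubst \<tau> A"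
proof (induction A arbitrary: \<sigma> \<tau>)
  case (Forall x F)
  then have "\<sigma> ` (free_vars F - {x}) = \<tau> ` (free_vars F - {x})" by (intro image_cong) auto
  moreover have "ssubst (\<sigma>(x := y)) F = ssubst (\<tau>(x := y)) F" for y
    using Forall.prems by (intro Forall.IH) auto
  ultimately show ?case by (simp only: ssubst.simps)
next
  case (Exists x F)
  then have "\<sigma> ` (free_vars F - {x}) = \<tau> ` (free_vars F - {x})" by (intro image_cong) auto
  moreover have "ssubst (\<sigma>(x := y)) F = ssubst (\<tau>(x := y)) F" for y
    using Exists.prems by (intro Exists.IH) auto
  ultimately show ?case by (simp only: ssubst.simps)
next
  case (Conj A B)
  from Conj.prems Conj.IH(1)[of \<sigma> \<tau>] Conj.IH(2)[of \<sigma> \<tau>] show ?case by simp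
next
  case (Disj A B)
  from Disj.prems Disj.IH(1)[of \<sigma> \<tau>] Disj.IH(2)[of \<sigma> \<tau>] show ?case by simp
next
  case (Imp A B)
  from Imp.prems Imp.IH(1)[of \<sigma> \<tau>] Imp.IH(2)[of \<sigma> \<tau>] show ?case by simp
next
  case (Neg A)
  from Neg.prems Neg.IH[of \<sigma> \<tau>] show ?case by simp
qed auto

lemma ssubst_upd_fresh: "a \<notin> vars A \<Longrightarrow> ssubst (\<sigma>(a := b)) A = ssubst \<sigma> A"
  using free_vars_subset_vars by (intro ssubst_cong) force

lemma ssubst_id: "ssubst id A = A"
proof (induction A)
  case (Forall x F)
  have "(\<lambda>z. z)(x := x) = (\<lambda>z::var. z)" by auto
  with Forall show ?case by (simp add: Let_def rename_bound_def id_def)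
next
  case (Exists x F)
  have "(\<lambda>z. z)(x := x) = (\<lambda>z::var. z)" by auto
  with Exists show ?case by (simp add: Let_def rename_bound_def id_def)
qed auto

text \<open>
  The results of applying \<open>\<sigma>\<close> to \<open>A\<close> under any capture-free choice of the bound variables.
  Unlike \<open>ssubst\<close>, which fixes one choice, this relation is closed under composition.
\<close>

primrec variant :: "(var \<Rightarrow> var) \<Rightarrow> 's fm \<Rightarrow> 's fm \<Rightarrow> bool" where
  "variant \<sigma> (Atom p ts) C \<longleftrightarrow> C = Atom p (map \<sigma> ts)"
| "variant \<sigma> Truth C \<longleftrightarrow> C = Truth"
| "variant \<sigma> Falsum C \<longleftrightarrow> C = Falsum"
| "variant \<sigma> (Conj A B) C \<longleftrightarrow> (\<exists>A' B'. C = Conj A' B' \<and> variant \<sigma> A A' \<and> variant \<sigma> B B')"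
| "variant \<sigma> (Disj A B) C \<longleftrightarrow> (\<exists>A' B'. C = Disj A' B' \<and> variant \<sigma> A A' \<and> variant \<sigma> B B')"
| "variant \<sigma> (Neg A) C \<longleftrightarrow> (\<exists>A'. C = Neg A' \<and> variant \<sigma> A A')"
| "variant \<sigma> (Imp A B) C \<longleftrightarrow> (\<exists>A' B'. C = Imp A' B' \<and> variant \<sigma> A A' \<and> variant \<sigma> B B')"
| "variant \<sigma> (Forall x F) C \<longleftrightarrow>
    (\<exists>y G. C = Forall y G \<and> y \<notin> \<sigma> ` (free_vars F - {x}) \<and> variant (\<sigma>(x := y)) F G)"
| "variant \<sigma> (Exists x F) C \<longleftrightarrow>
    (\<exists>y G. C = Exists y G \<and> y \<notin> \<sigma> ` (free_vars F - {x}) \<and> variant (\<sigma>(x := y)) F G)"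

lemma variant_free_vars: "variant \<sigma> A B \<Longrightarrow> free_vars B = \<sigma> ` free_vars A"
proof (induction A arbitrary: \<sigma> B)
  case (Forall x F)
  then show ?case using image_upd_fresh by fastforce
next
  case (Exists x F)
  then show ?case using image_upd_fresh by fastforce
qed fastforce+

lemma variant_is_formula: "variant \<sigma> A B \<Longrightarrow> is_formula ar A \<Longrightarrow> is_formula ar B"
proof (induction A arbitrary: \<sigma> B)
  case (Forall x F)
  then show ?case using variant_free_vars by fastforce
next
  case (Exists x F)
  then show ?case using variant_free_vars by fastforce
qed fastforce+

lemma variant_refl: "variant id A A"
proof (induction A)
  case (Forall x F)
  have "(\<lambda>z. z)(x := x) = (\<lambda>z::var. z)" by auto
  with Forall show ?case by (simp add: id_def)
next
  case (Exists x F)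
  have "(\<lambda>z. z)(x := x) = (\<lambda>z::var. z)" by auto
  with Exists show ?case by (simp add: id_def)
qed auto

lemma rename_bound_variant:
  assumes "variant (\<sigma>(x := y)) F G" "y \<notin> \<sigma> ` (free_vars F - {x})"
    and "\<forall>z\<in>free_vars F - {x}. \<rho> z = \<tau> (\<sigma> z)"
    and "y' = rename_bound y (\<tau> ` (free_vars G - {y}))"
  shows "y' \<notin> \<rho> ` (free_vars F - {x})"
    and "\<forall>z\<in>free_vars F. (\<rho>(x := y')) z = (\<tau>(y := y')) ((\<sigma>(x := y)) z)"
proof -
  have "free_vars G - {y} = \<sigma> ` (free_vars F - {x})"
    using variant_free_vars[OF assms(1)] image_upd_fresh[OF assms(2)] by simp
  then have "\<tau> ` (free_vars G - {y}) = \<rho> ` (free_vars F - {x})"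
    using assms(3) by (auto simp: image_iff)
  moreover have "y' \<notin> \<tau> ` (free_vars G - {y})"
    unfolding assms(4) by (rule rename_bound_fresh) (simp add: finite_free_vars)
  ultimately show "y' \<notin> \<rho> ` (free_vars F - {x})" by simp
  show "\<forall>z\<in>free_vars F. (\<rho>(x := y')) z = (\<tau>(y := y')) ((\<sigma>(x := y)) z)"
    using assms(2,3) by auto
qed

lemma variant_ssubst:
  "variant \<sigma> A B \<Longrightarrow> \<forall>z\<in>free_vars A. \<rho> z = \<tau> (\<sigma> z) \<Longrightarrow> variant \<rho> A (ssubst \<tau> B)"
proof (induction A arbitrary: \<sigma> \<rho> \<tau> B)
  case (Forall x F)
  then obtain y G where B: "B = Forall y G" and y: "y \<notin> \<sigma> ` (free_vars F - {x})"
    and G: "variant (\<sigma>(x := y)) F G" by auto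
  define y' where y': "y' = rename_bound y (\<tau> ` (free_vars G - {y}))"
  have "\<forall>z\<in>free_vars F - {x}. \<rho> z = \<tau> (\<sigma> z)" using Forall.prems(2) by simp
  note fresh = rename_bound_variant[OF G y this y']
  have "variant (\<rho>(x := y')) F (ssubst (\<tau>(y := y')) G)" using G fresh(2) by (rule Forall.IH)
  with fresh(1) show ?case by (simp add: B Let_def flip: y' del: fun_upd_apply)
next
  case (Exists x F)
  then obtain y G where B: "B = Exists y G" and y: "y \<notin> \<sigma> ` (free_vars F - {x})"
    and G: "variant (\<sigma>(x := y)) F G" by auto
  define y' where y': "y' = rename_bound y (\<tau> ` (free_vars G - {y}))"
  have "\<forall>z\<in>free_vars F - {x}. \<rho> z = \<tau> (\<sigma> z)" using Exists.prems(2) by simp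
  note fresh = rename_bound_variant[OF G y this y']
  have "variant (\<rho>(x := y')) F (ssubst (\<tau>(y := y')) G)" using G fresh(2) by (rule Exists.IH)
  with fresh(1) show ?case by (simp add: B Let_def flip: y' del: fun_upd_apply)
next
  case (Conj A1 A2)
  then show ?case by fastforce
next
  case (Disj A1 A2)
  then show ?case by fastforce
next
  case (Imp A1 A2)
  then show ?case by fastforce
qed auto

lemma variant_ssubst1: "variant \<sigma> A (ssubst \<sigma> A)"
  by (rule variant_ssubst[OF variant_refl]) simp

lemma variant_ssubst2:
  "\<forall>z\<in>free_vars A. \<rho> z = \<sigma> (\<tau> z) \<Longrightarrow> variant \<rho> A (ssubst \<sigma> (ssubst \<tau> A))"
  by (rule variant_ssubst[OF variant_ssubst1])

lemma variant_instance:
  assumes "variant (\<sigma>(x := y)) F G" "y \<notin> \<sigma> ` (free_vars F - {x})"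
  shows "variant (\<sigma>(x := a)) F (subst G y a)"
  unfolding subst_def using assms by (intro variant_ssubst[OF assms(1)]) auto

text \<open>
  Two bound variables with the same role are compared by instantiating both with the same
  eigenvariable; by \<open>variant_instance\<close> the instances are again variants of one formula, smaller
  than the quantified one, so that structural induction on the common origin goes through.
\<close>

lemma variant_derivable:
  "is_formula ar A \<Longrightarrow> variant \<sigma> A B \<Longrightarrow> variant \<sigma> A C \<Longrightarrow> LJp ar [B] (Some C)"
proof (induction A arbitrary: \<sigma> B C)
  case (Forall x F)
  obtain y G where B: "B = Forall y G" "y \<notin> \<sigma> ` (free_vars F - {x})"
    "variant (\<sigma>(x := y)) F G" using Forall.prems(2) by auto
  obtain z H where C: "C = Forall z H" "z \<notin> \<sigma> ` (free_vars F - {x})"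
    "variant (\<sigma>(x := z)) F H" using Forall.prems(3) by auto
  have "LJp ar [subst G y a] (Some (subst H z a))" for a
    using Forall.prems(1) variant_instance[OF B(3,2)] variant_instance[OF C(3,2)]
    by (auto intro: Forall.IH)
  then show ?case
    using Forall.prems variant_is_formula[of \<sigma> "Forall x F"] unfolding B(1) C(1)
    by (blast intro: Forall_mono)
next
  case (Exists x F)
  obtain y G where B: "B = Exists y G" "y \<notin> \<sigma> ` (free_vars F - {x})"
    "variant (\<sigma>(x := y)) F G" using Exists.prems(2) by auto
  obtain z H where C: "C = Exists z H" "z \<notin> \<sigma> ` (free_vars F - {x})"
    "variant (\<sigma>(x := z)) F H" using Exists.prems(3) by auto
  have "LJp ar [subst G y a] (Some (subst H z a))" for a
    using Exists.prems(1) variant_instance[OF B(3,2)] variant_instance[OF C(3,2)]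
    by (auto intro: Exists.IH)
  then show ?case
    using Exists.prems variant_is_formula[of \<sigma> "Exists x F"] unfolding B(1) C(1)
    by (blast intro: Exists_mono)
next
  case (Conj A1 A2)
  then show ?case by (auto intro!: Conj_mono)
next
  case (Disj A1 A2)
  then show ?case by (auto intro!: Disj_mono)
next
  case (Neg A)
  then show ?case by (auto intro!: Neg_mono)
next
  case (Imp A1 A2)
  then show ?case by (auto intro!: Imp_mono)
qed (auto intro!: LJp.axiom)

section \<open>Closure of derivability under substitution\<close>

text \<open>
  An eigenvariable \<open>a\<close> may clash with the variables introduced by \<open>\<sigma>\<close>.  Therefore, in the proof of
  \<open>LJp_ssubst\<close>, the induction hypothesis is applied to \<open>\<sigma>(a := b)\<close> with \<open>b\<close> fresh.
\<close>

lemma eigenvariable_variants: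
  assumes "a \<notin> vars F" and "y \<notin> \<sigma> ` (free_vars F - {x})"
  shows "variant (\<sigma>(x := b)) F (ssubst (\<sigma>(a := b)) (subst F x a))"
    and "variant (\<sigma>(x := b)) F (subst (ssubst (\<sigma>(x := y)) F) y b)"
proof -
  show "variant (\<sigma>(x := b)) F (ssubst (\<sigma>(a := b)) (subst F x a))"
    unfolding subst_def using assms(1) free_vars_subset_vars[of F]
    by (intro variant_ssubst2) auto
  show "variant (\<sigma>(x := b)) F (subst (ssubst (\<sigma>(x := y)) F) y b)"
    using variant_ssubst1 assms(2) by (rule variant_instance)
qed

lemma instance_variants:
  assumes "y \<notin> \<sigma> ` (free_vars F - {x})"
  shows "variant (\<sigma>(x := \<sigma> a)) F (ssubst \<sigma> (subst F x a))"
    and "variant (\<sigma>(x := \<sigma> a)) F (subst (ssubst (\<sigma>(x := y)) F) y (\<sigma> a))"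
proof -
  show "variant (\<sigma>(x := \<sigma> a)) F (ssubst \<sigma> (subst F x a))"
    unfolding subst_def by (intro variant_ssubst2) auto
  show "variant (\<sigma>(x := \<sigma> a)) F (subst (ssubst (\<sigma>(x := y)) F) y (\<sigma> a))"
    using variant_ssubst1 assms by (rule variant_instance)
qed

lemma ssubst_quantifier:
  obtains y where "y \<notin> \<sigma> ` (free_vars F - {x})"
    and "ssubst \<sigma> (Forall x F) = Forall y (ssubst (\<sigma>(x := y)) F)"
    and "ssubst \<sigma> (Exists x F) = Exists y (ssubst (\<sigma>(x := y)) F)"
proof
  let ?y = "rename_bound x (\<sigma> ` (free_vars F - {x}))"
  show "?y \<notin> \<sigma> ` (free_vars F - {x})"
    by (rule rename_bound_fresh) (simp add: finite_free_vars)
qed (simp_all add: Let_def)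

lemma propositional_ssubst:
  assumes "propositional ar N"
  shows "propositional ar (ssubst \<sigma> N)"
proof -
  have "symbols (ssubst \<sigma> N) = symbols N"
    by (induction N arbitrary: \<sigma>) (auto simp: Let_def)
  with assms show ?thesis by (simp add: propositional_def is_formula_ssubst)
qed

lemma LJp_ssubst:
  "LJp ar \<Gamma> \<Lambda> \<Longrightarrow> LJp ar (map (ssubst \<sigma>) \<Gamma>) (map_option (ssubst \<sigma>) \<Lambda>)"
proof (induction arbitrary: \<sigma> rule: LJp.induct)
  case (exchange \<Pi> A B \<Gamma> \<Lambda>)
  from exchange.IH[of \<sigma>] show ?case by (simp add: LJp.exchange)
next
  case (cut \<Gamma> C \<Pi> \<Lambda>)
  from LJp.cut[of ar "map (ssubst \<sigma>) \<Gamma>" "ssubst \<sigma> C"] cut.IH[of \<sigma>] show ?case by simp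
next
  case (imp_left \<Gamma> A B \<Pi> \<Lambda>)
  from LJp.imp_left[of ar "map (ssubst \<sigma>) \<Gamma>" "ssubst \<sigma> A" "ssubst \<sigma> B"] imp_left.IH[of \<sigma>]
  show ?case by simp
next
  case (forall_right \<Gamma> F x a)
  obtain y where y: "y \<notin> \<sigma> ` (free_vars F - {x})"
    and eq: "ssubst \<sigma> (Forall x F) = Forall y (ssubst (\<sigma>(x := y)) F)" by (rule ssubst_quantifier)
  obtain b where b: "\<forall>C\<in>set (ssubst \<sigma> (Forall x F) # map (ssubst \<sigma>) \<Gamma>). b \<notin> vars C"
    by (rule fresh_var)
  have \<Gamma>: "map (ssubst (\<sigma>(a := b))) \<Gamma> = map (ssubst \<sigma>) \<Gamma>"
    using forall_right.hyps by (simp add: ssubst_upd_fresh)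
  have "LJp ar [ssubst (\<sigma>(a := b)) (subst F x a)] (Some (subst (ssubst (\<sigma>(x := y)) F) y b))"
    using forall_right.hyps y by (intro variant_derivable[OF _ eigenvariable_variants]) auto
  with forall_right.IH[of "\<sigma>(a := b)"]
  have "LJp ar (map (ssubst \<sigma>) \<Gamma>) (Some (subst (ssubst (\<sigma>(x := y)) F) y b))"
    unfolding \<Gamma> option.map by (rule LJp_cut_right)
  moreover have "is_formula ar (Forall y (ssubst (\<sigma>(x := y)) F))"
    unfolding eq[symmetric] using forall_right.hyps(2) by (rule is_formula_ssubst)
  ultimately have "LJp ar (map (ssubst \<sigma>) \<Gamma>) (Some (Forall y (ssubst (\<sigma>(x := y)) F)))"
    using b unfolding eq by (intro LJp.forall_right[where a = b]) auto
  then show ?case by (simp only: eq option.map)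
next
  case (forall_left F x a \<Gamma> \<Lambda>)
  obtain y where y: "y \<notin> \<sigma> ` (free_vars F - {x})"
    and eq: "ssubst \<sigma> (Forall x F) = Forall y (ssubst (\<sigma>(x := y)) F)" by (rule ssubst_quantifier)
  have "LJp ar [subst (ssubst (\<sigma>(x := y)) F) y (\<sigma> a)] (Some (ssubst \<sigma> (subst F x a)))"
    using forall_left.hyps y by (intro variant_derivable[OF _ instance_variants(2,1)]) auto
  from this forall_left.IH[of \<sigma>]
  have "LJp ar (subst (ssubst (\<sigma>(x := y)) F) y (\<sigma> a) # map (ssubst \<sigma>) \<Gamma>)
      (map_option (ssubst \<sigma>) \<Lambda>)"
    unfolding list.map by (rule LJp_cut_left)
  moreover have "is_formula ar (Forall y (ssubst (\<sigma>(x := y)) F))"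
    unfolding eq[symmetric] using forall_left.hyps(2) by (rule is_formula_ssubst)
  ultimately show ?case unfolding list.map eq by (rule LJp.forall_left)
next
  case (exists_right \<Gamma> F x a)
  obtain y where y: "y \<notin> \<sigma> ` (free_vars F - {x})"
    and eq: "ssubst \<sigma> (Exists x F) = Exists y (ssubst (\<sigma>(x := y)) F)" by (rule ssubst_quantifier)
  have "LJp ar [ssubst \<sigma> (subst F x a)] (Some (subst (ssubst (\<sigma>(x := y)) F) y (\<sigma> a)))"
    using exists_right.hyps y by (intro variant_derivable[OF _ instance_variants]) auto
  with exists_right.IH[of \<sigma>]
  have "LJp ar (map (ssubst \<sigma>) \<Gamma>) (Some (subst (ssubst (\<sigma>(x := y)) F) y (\<sigma> a)))"
    unfolding option.map by (rule LJp_cut_right)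
  moreover have "is_formula ar (Exists y (ssubst (\<sigma>(x := y)) F))"
    unfolding eq[symmetric] using exists_right.hyps(2) by (rule is_formula_ssubst)
  ultimately show ?case unfolding option.map eq by (rule LJp.exists_right)
next
  case (exists_left F x a \<Gamma> \<Lambda>)
  obtain y where y: "y \<notin> \<sigma> ` (free_vars F - {x})"
    and eq: "ssubst \<sigma> (Exists x F) = Exists y (ssubst (\<sigma>(x := y)) F)" by (rule ssubst_quantifier)
  obtain b where b: "\<forall>C\<in>set (ssubst \<sigma> (Exists x F) # map (ssubst \<sigma>) \<Gamma> @
      (case \<Lambda> of None \<Rightarrow> [] | Some A \<Rightarrow> [ssubst \<sigma> A])). b \<notin> vars C"
    by (rule fresh_var)
  have \<Gamma>: "map (ssubst (\<sigma>(a := b))) \<Gamma> = map (ssubst \<sigma>) \<Gamma>"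
    and \<Lambda>: "map_option (ssubst (\<sigma>(a := b))) \<Lambda> = map_option (ssubst \<sigma>) \<Lambda>"
    using exists_left.hyps by (cases \<Lambda>; simp add: ssubst_upd_fresh)+
  have "LJp ar [subst (ssubst (\<sigma>(x := y)) F) y b] (Some (ssubst (\<sigma>(a := b)) (subst F x a)))"
    using exists_left.hyps y by (intro variant_derivable[OF _ eigenvariable_variants(2,1)]) auto
  from this exists_left.IH[of "\<sigma>(a := b)"]
  have "LJp ar (subst (ssubst (\<sigma>(x := y)) F) y b # map (ssubst \<sigma>) \<Gamma>)
      (map_option (ssubst \<sigma>) \<Lambda>)"
    unfolding \<Lambda> list.map \<Gamma> by (rule LJp_cut_left)
  moreover have "is_formula ar (Exists y (ssubst (\<sigma>(x := y)) F))"
    unfolding eq[symmetric] using exists_left.hyps(2) by (rule is_formula_ssubst)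
  ultimately show ?case
    using b unfolding list.map eq
    by (intro LJp.exists_left[where a = b]) (auto split: option.splits)
next
  case (neutralization N \<Gamma> \<Lambda>)
  from neutralization.IH[of \<sigma>] propositional_ssubst[OF neutralization.hyps(3)] show ?case
    by - (rule LJp.neutralization[where N = "ssubst \<sigma> N"]; simp)
next
  case (contraction A \<Gamma> \<Lambda>)
  then show ?case by (simp add: LJp.contraction)
qed (auto intro: LJp_logical simp: is_formula_ssubst)

section \<open>Replacing propositional symbols by truth values\<close>

text \<open>
  In a formula the empty argument list identifies the propositional symbols.  Testing for it
  instead of the arity makes the laws below hold for all expressions.
\<close>

primrec psub :: "('s \<Rightarrow> bool) \<Rightarrow> 's fm \<Rightarrow> 's fm" where
  "psub v (Atom p ts) = (if ts = [] then (if v p then Truth else Falsum) else Atom p ts)"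
| "psub v Truth = Truth"
| "psub v Falsum = Falsum"
| "psub v (Conj A B) = Conj (psub v A) (psub v B)"
| "psub v (Disj A B) = Disj (psub v A) (psub v B)"
| "psub v (Neg A) = Neg (psub v A)"
| "psub v (Imp A B) = Imp (psub v A) (psub v B)"
| "psub v (Forall x F) = Forall x (psub v F)"
| "psub v (Exists x F) = Exists x (psub v F)"

lemma free_vars_psub [simp]: "free_vars (psub v A) = free_vars A"
  by (induction A) auto

lemma vars_psub [simp]: "vars (psub v A) = vars A"
  by (induction A) auto

lemma psub_ssubst: "psub v (ssubst \<sigma> A) = ssubst \<sigma> (psub v A)"
  by (induction A arbitrary: \<sigma>) (auto simp: Let_def)

lemma psub_subst: "psub v (subst F x a) = subst (psub v F) x a"
  by (simp add: subst_def psub_ssubst)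

lemma is_formula_psub: "is_formula ar A \<Longrightarrow> is_formula ar (psub v A)"
  by (induction A) auto

lemma propositional_psub: "propositional ar N \<Longrightarrow> propositional ar (psub v N)"
  unfolding propositional_def by (induction N) auto

lemma LJp_psub: "LJp ar \<Gamma> \<Lambda> \<Longrightarrow> LJp ar (map (psub v) \<Gamma>) (map_option (psub v) \<Lambda>)"
proof (induction rule: LJp.induct)
  case (exchange \<Pi> A B \<Gamma> \<Lambda>)
  then show ?case by (simp add: LJp.exchange)
next
  case (cut \<Gamma> C \<Pi> \<Lambda>)
  with LJp.cut[of ar "map (psub v) \<Gamma>" "psub v C"] show ?case by simp
next
  case (imp_left \<Gamma> A B \<Pi> \<Lambda>)
  with LJp.imp_left[of ar "map (psub v) \<Gamma>" "psub v A" "psub v B"] show ?case by simp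
next
  case (forall_right \<Gamma> F x a)
  then show ?case
    by (auto simp: psub_subst is_formula_psub intro!: LJp.forall_right[where a = a])
next
  case (forall_left F x a \<Gamma> \<Lambda>)
  then show ?case
    by (auto simp: psub_subst is_formula_psub intro!: LJp.forall_left[where a = a])
next
  case (exists_right \<Gamma> F x a)
  then show ?case
    by (auto simp: psub_subst is_formula_psub intro!: LJp.exists_right[where a = a])
next
  case (exists_left F x a \<Gamma> \<Lambda>)
  then show ?case
    by (auto simp: psub_subst is_formula_psub option.set_map intro!: LJp.exists_left[where a = a])
next
  case (neutralization N \<Gamma> \<Lambda>)
  from neutralization.IH neutralization.hyps(3) show ?case
    by - (rule LJp.neutralization[where N = "psub v N"]; simp add: propositional_psub)
next
  case (contraction A \<Gamma> \<Lambda>)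
  then show ?case by (simp add: LJp.contraction)
qed (auto intro: LJp_logical simp: is_formula_psub)

section \<open>Polarity\<close>

lemma occurs_trans: "occurs B s C \<Longrightarrow> occurs A s' B \<Longrightarrow> occurs A (s = s') C"
proof (induction rule: occurs.induct)
  case (neg s D)
  then have "occurs A (\<not> (s = s')) D" by (intro occurs.neg)
  moreover have "(\<not> (s = s')) = ((\<not> s) = s')" by auto
  ultimately show ?case by simp
next
  case (imp1 s D E)
  then have "occurs A (\<not> (s = s')) D" by (intro occurs.imp1)
  moreover have "(\<not> (s = s')) = ((\<not> s) = s')" by auto
  ultimately show ?case by simp
qed (auto intro: occurs.intros)

lemma occurs_in_positive: "occurs A s C \<Longrightarrow> occurs B True A \<Longrightarrow> occurs B s C"
  using occurs_trans[of A s C B True] by simp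

lemma occurs_in_negative: "occurs A s C \<Longrightarrow> occurs B False A \<Longrightarrow> occurs B (\<not> s) C"
  using occurs_trans[of A s C B False] by simp

lemma occurs_sub:
  "occurs A s C \<Longrightarrow> occurs (Conj A B) s C"
  "occurs B s C \<Longrightarrow> occurs (Conj A B) s C"
  "occurs A s C \<Longrightarrow> occurs (Disj A B) s C"
  "occurs B s C \<Longrightarrow> occurs (Disj A B) s C"
  "occurs A s C \<Longrightarrow> occurs (Neg A) (\<not> s) C"
  "occurs A s C \<Longrightarrow> occurs (Imp A B) (\<not> s) C"
  "occurs B s C \<Longrightarrow> occurs (Imp A B) s C"
  "occurs A s C \<Longrightarrow> occurs (Forall x A) s C"
  "occurs A s C \<Longrightarrow> occurs (Exists x A) s C"
  by (erule occurs_in_positive, rule occurs.conj1[OF occurs.self])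
    (erule occurs_in_positive, rule occurs.conj2[OF occurs.self],
     erule occurs_in_positive, rule occurs.disj1[OF occurs.self],
     erule occurs_in_positive, rule occurs.disj2[OF occurs.self],
     erule occurs_in_negative, rule occurs.neg[OF occurs.self, simplified],
     erule occurs_in_negative, rule occurs.imp1[OF occurs.self, simplified],
     erule occurs_in_positive, rule occurs.imp2[OF occurs.self],
     erule occurs_in_positive, rule occurs.forall[OF occurs.self],
     erule occurs_in_positive, rule occurs.exists[OF occurs.self])

text \<open>
  \<open>\<bottom>\<close> entails every symbol and every symbol entails \<open>\<top>\<close>; the connectives and quantifiers
  propagate this along the polarities.  The two directions exchange their roles at every change
  of polarity, so they are proved together.
\<close>

lemma psub_polarity:
  assumes "is_formula ar A"
  shows "\<forall>p s. occurs A s (Atom p []) \<longrightarrow> v p = (\<not> s) \<Longrightarrow> LJp ar [psub v A] (Some A)"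
    and "\<forall>p s. occurs A s (Atom p []) \<longrightarrow> v p = s \<Longrightarrow> LJp ar [A] (Some (psub v A))"
  using assms
proof (induction A)
  case (Atom p ts)
  have self: "occurs (Atom p ts) True (Atom p ts)" by (rule occurs.self)
  {
    case 1
    with self have "ts = [] \<Longrightarrow> \<not> v p" by auto
    with 1 show ?case by (auto intro: LJp.axiom LJp.falsum LJp.truth LJp.thin_left LJp.thin_right)
  next
    case 2
    with self have "ts = [] \<Longrightarrow> v p" by auto
    with 2 show ?case by (auto intro: LJp.axiom LJp.falsum LJp.truth LJp.thin_left LJp.thin_right)
  }
next
  case Truth
  { case 1 show ?case by (simp add: LJp.axiom) next case 2 show ?case by (simp add: LJp.axiom) }
next
  case Falsum
  { case 1 show ?case by (simp add: LJp.axiom) next case 2 show ?case by (simp add: LJp.axiom) }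
next
  case (Conj A B)
  { case 1 with Conj.IH show ?case by (auto intro!: Conj_mono simp: occurs_sub)
  next case 2 with Conj.IH show ?case by (auto intro!: Conj_mono simp: occurs_sub) }
next
  case (Disj A B)
  { case 1 with Disj.IH show ?case by (auto intro!: Disj_mono simp: occurs_sub)
  next case 2 with Disj.IH show ?case by (auto intro!: Disj_mono simp: occurs_sub) }
next
  case (Neg A)
  have occ: "occurs (Neg A) (\<not> s) C" if "occurs A s C" for s C using that by (rule occurs_sub)
  {
    case 1
    then have "\<forall>p s. occurs A s (Atom p []) \<longrightarrow> v p = s" using occ by blast
    with Neg.IH(2) 1 show ?case by (auto intro!: Neg_mono)
  next
    case 2
    then have "\<forall>p s. occurs A s (Atom p []) \<longrightarrow> v p = (\<not> s)" using occ by blast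
    with Neg.IH(1) 2 show ?case by (auto intro!: Neg_mono)
  }
next
  case (Imp A B)
  have occ: "occurs (Imp A B) (\<not> s) C" if "occurs A s C" for s C using that by (rule occurs_sub)
  {
    case 1
    then have "\<forall>p s. occurs A s (Atom p []) \<longrightarrow> v p = s" using occ by blast
    with Imp.IH 1 show ?case by (auto intro!: Imp_mono simp: occurs_sub)
  next
    case 2
    then have "\<forall>p s. occurs A s (Atom p []) \<longrightarrow> v p = (\<not> s)" using occ by blast
    with Imp.IH 2 show ?case by (auto intro!: Imp_mono simp: occurs_sub)
  }
next
  case (Forall x F)
  {
    case 1
    with Forall.IH(1) have "LJp ar [psub v F] (Some F)" by (auto simp: occurs_sub)
    from LJp_ssubst[OF this] 1 show ?case
      by (auto intro!: Forall_mono simp: subst_def is_formula_psub)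
  next
    case 2
    with Forall.IH(2) have "LJp ar [F] (Some (psub v F))" by (auto simp: occurs_sub)
    from LJp_ssubst[OF this] 2 show ?case
      by (auto intro!: Forall_mono simp: subst_def is_formula_psub)
  }
next
  case (Exists x F)
  {
    case 1
    with Exists.IH(1) have "LJp ar [psub v F] (Some F)" by (auto simp: occurs_sub)
    from LJp_ssubst[OF this] 1 show ?case
      by (auto intro!: Exists_mono simp: subst_def is_formula_psub)
  next
    case 2
    with Exists.IH(2) have "LJp ar [F] (Some (psub v F))" by (auto simp: occurs_sub)
    from LJp_ssubst[OF this] 2 show ?case
      by (auto intro!: Exists_mono simp: subst_def is_formula_psub)
  }
qed

section \<open>The slash\<close>

definition holds :: "('s \<Rightarrow> nat) \<Rightarrow> ('s \<Rightarrow> bool) \<Rightarrow> (var \<Rightarrow> var) \<Rightarrow> 's fm \<Rightarrow> bool" where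
  "holds ar v \<sigma> A \<longleftrightarrow> LJp ar [] (Some (psub v (ssubst \<sigma> A)))"

text \<open>
  Aczel's variant of Kleene's slash, which builds derivability into every clause.  The free
  variables are interpreted by an environment \<open>\<sigma>\<close>, so that the recursion is structural.  For a
  propositional symbol the clause asks for its truth under \<open>v\<close>, rather than for derivability
  alone: thus \<open>\<bottom>\<close> put for a false symbol is not slashed, and the consistency of
  the calculus need not be known beforehand.
\<close>

primrec slash :: "('s \<Rightarrow> nat) \<Rightarrow> ('s \<Rightarrow> bool) \<Rightarrow> (var \<Rightarrow> var) \<Rightarrow> 's fm \<Rightarrow> bool" where
  "slash ar v \<sigma> (Atom p ts) \<longleftrightarrow> holds ar v \<sigma> (Atom p ts) \<and> (ts = [] \<longrightarrow> v p)"
| "slash ar v \<sigma> Truth \<longleftrightarrow> holds ar v \<sigma> Truth"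
| "slash ar v \<sigma> Falsum \<longleftrightarrow> False"
| "slash ar v \<sigma> (Conj A B) \<longleftrightarrow> holds ar v \<sigma> (Conj A B) \<and> slash ar v \<sigma> A \<and> slash ar v \<sigma> B"
| "slash ar v \<sigma> (Disj A B) \<longleftrightarrow> holds ar v \<sigma> (Disj A B) \<and> (slash ar v \<sigma> A \<or> slash ar v \<sigma> B)"
| "slash ar v \<sigma> (Neg A) \<longleftrightarrow> holds ar v \<sigma> (Neg A) \<and> \<not> slash ar v \<sigma> A"
| "slash ar v \<sigma> (Imp A B) \<longleftrightarrow>
    holds ar v \<sigma> (Imp A B) \<and> (slash ar v \<sigma> A \<longrightarrow> slash ar v \<sigma> B)"
| "slash ar v \<sigma> (Forall x F) \<longleftrightarrow>
    holds ar v \<sigma> (Forall x F) \<and> (\<forall>a. slash ar v (\<sigma>(x := a)) F)"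
| "slash ar v \<sigma> (Exists x F) \<longleftrightarrow>
    holds ar v \<sigma> (Exists x F) \<and> (\<exists>a. slash ar v (\<sigma>(x := a)) F)"

lemma slash_holds: "slash ar v \<sigma> A \<Longrightarrow> holds ar v \<sigma> A"
  by (cases A) simp_all

lemma holds_cong: "\<forall>z\<in>free_vars A. \<sigma> z = \<tau> z \<Longrightarrow> holds ar v \<sigma> A = holds ar v \<tau> A"
  unfolding holds_def by (simp add: ssubst_cong[of A \<sigma> \<tau>])

lemma slash_cong: "\<forall>z\<in>free_vars A. \<sigma> z = \<tau> z \<Longrightarrow> slash ar v \<sigma> A = slash ar v \<tau> A"
proof (induction A arbitrary: \<sigma> \<tau>)
  case (Forall x F)
  have "slash ar v (\<sigma>(x := a)) F = slash ar v (\<tau>(x := a)) F" for a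
    using Forall.prems by (intro Forall.IH) auto
  with holds_cong[OF Forall.prems] show ?case by simp
next
  case (Exists x F)
  have "slash ar v (\<sigma>(x := a)) F = slash ar v (\<tau>(x := a)) F" for a
    using Exists.prems by (intro Exists.IH) auto
  with holds_cong[OF Exists.prems] show ?case by simp
next
  case (Conj A B)
  from holds_cong[OF Conj.prems] Conj.IH[of \<sigma> \<tau>] Conj.prems show ?case by simp
next
  case (Disj A B)
  from holds_cong[OF Disj.prems] Disj.IH[of \<sigma> \<tau>] Disj.prems show ?case by simp
next
  case (Imp A B)
  from holds_cong[OF Imp.prems] Imp.IH[of \<sigma> \<tau>] Imp.prems show ?case by simp
next
  case (Neg A)
  from holds_cong[OF Neg.prems] Neg.IH[of \<sigma> \<tau>] Neg.prems show ?case by simp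
next
  case (Atom p ts)
  from holds_cong[OF Atom.prems] show ?case by simp
next
  case Truth
  from holds_cong[OF Truth.prems] show ?case by simp
qed simp

lemma slash_upd_fresh: "a \<notin> vars A \<Longrightarrow> slash ar v (\<sigma>(a := b)) A = slash ar v \<sigma> A"
  using free_vars_subset_vars by (intro slash_cong) force

lemma holds_ssubst:
  assumes "is_formula ar A" and "\<forall>z\<in>free_vars A. \<rho> z = \<sigma> (\<tau> z)"
  shows "holds ar v \<sigma> (ssubst \<tau> A) = holds ar v \<rho> A"
proof -
  have form: "is_formula ar (psub v A)" using assms(1) by (rule is_formula_psub)
  have "variant \<rho> (psub v A) (ssubst \<sigma> (ssubst \<tau> (psub v A)))"
    using assms(2) by (intro variant_ssubst2) simp
  note derivable = variant_derivable[OF form this variant_ssubst1]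
    variant_derivable[OF form variant_ssubst1 this]
  then show ?thesis
    unfolding holds_def psub_ssubst by (blast intro: LJp_cut_right)
qed

lemma slash_ssubst:
  "is_formula ar A \<Longrightarrow> \<forall>z\<in>free_vars A. \<rho> z = \<sigma> (\<tau> z) \<Longrightarrow>
    slash ar v \<sigma> (ssubst \<tau> A) = slash ar v \<rho> A"
proof (induction A arbitrary: \<rho> \<sigma> \<tau>)
  case (Forall x F)
  obtain y where y: "y \<notin> \<tau> ` (free_vars F - {x})"
    and eq: "ssubst \<tau> (Forall x F) = Forall y (ssubst (\<tau>(x := y)) F)" by (rule ssubst_quantifier)
  have "slash ar v (\<sigma>(y := a)) (ssubst (\<tau>(x := y)) F) = slash ar v (\<rho>(x := a)) F" for a
    using Forall.prems y by (intro Forall.IH) auto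
  with holds_ssubst[of ar _ \<rho> \<sigma> \<tau> v, OF Forall.prems] show ?case unfolding eq by simp
next
  case (Exists x F)
  obtain y where y: "y \<notin> \<tau> ` (free_vars F - {x})"
    and eq: "ssubst \<tau> (Exists x F) = Exists y (ssubst (\<tau>(x := y)) F)" by (rule ssubst_quantifier)
  have "slash ar v (\<sigma>(y := a)) (ssubst (\<tau>(x := y)) F) = slash ar v (\<rho>(x := a)) F" for a
    using Exists.prems y by (intro Exists.IH) auto
  with holds_ssubst[of ar _ \<rho> \<sigma> \<tau> v, OF Exists.prems] show ?case unfolding eq by simp
next
  case (Conj A B)
  from holds_ssubst[of ar _ \<rho> \<sigma> \<tau> v, OF Conj.prems] Conj.IH[of \<rho> \<sigma> \<tau>] Conj.prems
  show ?case by simp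
next
  case (Disj A B)
  from holds_ssubst[of ar _ \<rho> \<sigma> \<tau> v, OF Disj.prems] Disj.IH[of \<rho> \<sigma> \<tau>] Disj.prems
  show ?case by simp
next
  case (Imp A B)
  from holds_ssubst[of ar _ \<rho> \<sigma> \<tau> v, OF Imp.prems] Imp.IH[of \<rho> \<sigma> \<tau>] Imp.prems
  show ?case by simp
next
  case (Neg A)
  from holds_ssubst[of ar _ \<rho> \<sigma> \<tau> v, OF Neg.prems] Neg.IH[of \<rho> \<sigma> \<tau>] Neg.prems
  show ?case by simp
next
  case (Atom p ts)
  from holds_ssubst[of ar _ \<rho> \<sigma> \<tau> v, OF Atom.prems] show ?case by simp
next
  case Truth
  from holds_ssubst[of ar _ \<rho> \<sigma> \<tau> v, OF Truth.prems] show ?case by simp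
qed simp

lemma slash_subst:
  "is_formula ar F \<Longrightarrow> slash ar v \<sigma> (subst F x a) = slash ar v (\<sigma>(x := \<sigma> a)) F"
  unfolding subst_def by (intro slash_ssubst) auto

lemma slash_subst_fresh:
  assumes "is_formula ar F" and "a \<notin> vars F"
  shows "slash ar v (\<sigma>(a := b)) (subst F x a) = slash ar v (\<sigma>(x := b)) F"
  unfolding subst_def using assms free_vars_subset_vars[of F] by (intro slash_ssubst) auto

text \<open>
  Propositional formulas are quantifier-free, because a quantified formula must bind a variable
  that occurs in its scope.
\<close>

lemma propositional_free_vars: "propositional ar N \<Longrightarrow> free_vars N = {}"
  by (induction N) (auto simp: propositional_def)

text \<open>
  This makes the slash sound for neutralization: the replacement of the propositional symbols
  decides every propositional formula.  Refutability is stated as a sequent with empty succedent, which makes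
  each case below an instance of rules of the calculus.
\<close>

lemma slash_propositional:
  "propositional ar N \<Longrightarrow> \<not> slash ar v \<sigma> N \<Longrightarrow> LJp ar [psub v (ssubst \<sigma> N)] None"
proof (induction N)
  case (Atom p ts)
  then have "ts = []" by (auto simp: propositional_def)
  with Atom.prems show ?case by (auto simp: holds_def LJp.truth LJp.falsum)
next
  case Truth
  then show ?case by (simp add: holds_def LJp.truth)
next
  case Falsum
  show ?case by (simp add: LJp.falsum)
next
  case (Conj A B)
  have props: "propositional ar A" "propositional ar B"
    using Conj.prems(1) by (auto simp: propositional_def)
  then have form: "is_formula ar (psub v (ssubst \<sigma> A))" "is_formula ar (psub v (ssubst \<sigma> B))"
    by (auto simp: propositional_def is_formula_psub is_formula_ssubst)
  have "holds ar v \<sigma> (Conj A B)" if "slash ar v \<sigma> A" "slash ar v \<sigma> B"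
    using that[THEN slash_holds] by (simp add: holds_def LJp.conj_right)
  with Conj.prems(2) have "\<not> slash ar v \<sigma> A \<or> \<not> slash ar v \<sigma> B" by auto
  then show ?case
    using Conj.IH props form by (auto intro: LJp.conj_left1 LJp.conj_left2)
next
  case (Disj A B)
  have props: "propositional ar A" "propositional ar B"
    using Disj.prems(1) by (auto simp: propositional_def)
  then have form: "is_formula ar (psub v (ssubst \<sigma> A))" "is_formula ar (psub v (ssubst \<sigma> B))"
    by (auto simp: propositional_def is_formula_psub is_formula_ssubst)
  have "holds ar v \<sigma> (Disj A B)" if "slash ar v \<sigma> A"
    using slash_holds[OF that] form unfolding holds_def by (simp add: LJp.disj_right1)
  moreover have "holds ar v \<sigma> (Disj A B)" if "slash ar v \<sigma> B"
    using slash_holds[OF that] form unfolding holds_def by (simp add: LJp.disj_right2)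
  ultimately have "\<not> slash ar v \<sigma> A" "\<not> slash ar v \<sigma> B" using Disj.prems(2)
    unfolding slash.simps by blast+
  then show ?case
    using Disj.IH props by (auto intro: LJp.disj_left)
next
  case (Neg A)
  have "propositional ar A" using Neg.prems(1) by (auto simp: propositional_def)
  then have "slash ar v \<sigma> A"
    using Neg by (auto simp: holds_def intro: LJp.neg_right)
  then show ?case
    using slash_holds[of ar v \<sigma> A] by (auto simp: holds_def intro: LJp.neg_left)
next
  case (Imp A B)
  have props: "propositional ar A" "propositional ar B"
    using Imp.prems(1) by (auto simp: propositional_def)
  then have form: "is_formula ar (psub v (ssubst \<sigma> A))" "is_formula ar (psub v (ssubst \<sigma> B))"
    by (auto simp: propositional_def is_formula_psub is_formula_ssubst)
  have "holds ar v \<sigma> (Imp A B)" if "\<not> slash ar v \<sigma> A"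
    using Imp.IH(1)[OF props(1) that] form unfolding holds_def
    by (simp add: LJp.imp_right LJp.thin_right)
  moreover have "holds ar v \<sigma> (Imp A B)" if "slash ar v \<sigma> B"
    using slash_holds[OF that] form unfolding holds_def by (simp add: LJp.imp_right LJp.thin_left)
  ultimately have A: "slash ar v \<sigma> A" and "\<not> slash ar v \<sigma> B" using Imp.prems(2)
    unfolding slash.simps by blast+
  then show ?case
    using Imp.IH(2) props slash_holds[OF A] LJp.imp_left[of ar "[]" _ _ "[]"]
    by (simp add: holds_def)
next
  case (Forall x F)
  then show ?case using propositional_free_vars[of ar F] by (auto simp: propositional_def)
next
  case (Exists x F)
  then show ?case using propositional_free_vars[of ar F] by (auto simp: propositional_def)
qed

lemma holds_sound:
  assumes "LJp ar \<Gamma> (Some A)" "\<forall>C\<in>set \<Gamma>. slash ar v \<sigma> C"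
  shows "holds ar v \<sigma> A"
  using LJp_cut_all[OF LJp_psub[OF LJp_ssubst[OF assms(1)]]] assms(2) slash_holds
  by (fastforce simp: holds_def)

text \<open>
  For every rule introducing a connective in the succedent, the derivability part of the slash is
  \<open>holds_sound\<close> applied to the conclusion of the rule.
\<close>

lemma slash_sound:
  "LJp ar \<Gamma> \<Lambda> \<Longrightarrow> \<forall>C\<in>set \<Gamma>. slash ar v \<sigma> C \<Longrightarrow> \<exists>A. \<Lambda> = Some A \<and> slash ar v \<sigma> A"
proof (induction arbitrary: \<sigma> rule: LJp.induct)
  case truth
  then show ?case using holds_sound[OF LJp.truth] by simp
next
  case (conj_right \<Gamma> A B)
  then show ?case using holds_sound[OF LJp.conj_right] by fastforce
next
  case (disj_right1 \<Gamma> A B)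
  then show ?case using holds_sound[OF LJp.disj_right1] by fastforce
next
  case (disj_right2 \<Gamma> B A)
  then show ?case using holds_sound[OF LJp.disj_right2] by fastforce
next
  case (neg_right A \<Gamma>)
  then show ?case using holds_sound[OF LJp.neg_right] by fastforce
next
  case (imp_right A \<Gamma> B)
  then show ?case using holds_sound[OF LJp.imp_right] by fastforce
next
  case (forall_right \<Gamma> F x a)
  have "holds ar v \<sigma> (Forall x F)"
    using holds_sound[OF LJp.forall_right] forall_right.hyps forall_right.prems by blast
  moreover have "slash ar v (\<sigma>(x := b)) F" for b
  proof -
    have "\<forall>C\<in>set \<Gamma>. slash ar v (\<sigma>(a := b)) C"
      using forall_right by (simp add: slash_upd_fresh)
    from forall_right.IH[OF this] forall_right.hyps show ?thesis
      by (simp add: slash_subst_fresh del: fun_upd_apply)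
  qed
  ultimately show ?case by simp
next
  case (forall_left F x a \<Gamma> \<Lambda>)
  then show ?case by (auto simp: slash_subst)
next
  case (exists_right \<Gamma> F x a)
  have "holds ar v \<sigma> (Exists x F)"
    using holds_sound[OF LJp.exists_right] exists_right.hyps exists_right.prems by blast
  then show ?case using exists_right.IH exists_right.prems exists_right.hyps
    by (auto simp: slash_subst)
next
  case (exists_left F x a \<Gamma> \<Lambda>)
  then obtain b where "slash ar v (\<sigma>(x := b)) F" by auto
  then have "\<forall>C\<in>set (subst F x a # \<Gamma>). slash ar v (\<sigma>(a := b)) C"
    using exists_left by (auto simp: slash_upd_fresh slash_subst_fresh)
  from exists_left.IH[OF this] exists_left.hyps show ?case 
    by (auto simp: slash_upd_fresh simp del: fun_upd_apply)
next
  case (neutralization N \<Gamma> \<Lambda>)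
  show ?case
  proof (cases "slash ar v \<sigma> N")
    case False
    with slash_propositional[OF neutralization.hyps(3) this] have "slash ar v \<sigma> (Neg N)"
      by (auto simp: holds_def intro: LJp.neg_right)
    with neutralization show ?thesis by simp
  qed (use neutralization in simp)
next
  case (cut \<Gamma> C \<Pi> \<Lambda>)
  then show ?case by fastforce
next
  case (imp_left \<Gamma> A B \<Pi> \<Lambda>)
  then show ?case by fastforce
qed auto

section \<open>The disjunction and existence properties\<close>

lemma unipolar_valuation:
  assumes "unipolar ar A" "is_formula ar A"
  obtains v where "\<And>p s. occurs A s (Atom p []) \<Longrightarrow> v p = (\<not> s)"
proof
  fix p s
  assume occ: "occurs A s (Atom p [])"
  have "is_formula ar B" if "occurs A s B" for s B
    using that assms(2) by induction auto
  from this[OF occ] have "ar p = 0" by simp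
  with assms(1) occ show "(\<not> occurs A True (Atom p [])) = (\<not> s)"
    unfolding unipolar_def by (cases s) metis+
qed

lemma derivable_if_slash:
  assumes "is_formula ar A" "\<And>p s. occurs A s (Atom p []) \<Longrightarrow> v p = (\<not> s)"
    and "slash ar v \<sigma> A"
  shows "derivable ar (ssubst \<sigma> A)"
proof -
  have "LJp ar [psub v A] (Some A)" using psub_polarity(1) assms(1,2) by blast
  from LJp_ssubst[OF this, of \<sigma>] slash_holds[OF assms(3)] show ?thesis
    by (auto simp: derivable_def holds_def psub_ssubst intro: LJp_cut_right)
qed

theorem mainTheorem10:
  fixes ar :: "'s \<Rightarrow> nat"
  shows "(\<forall>A B. is_formula ar (Disj A B) \<longrightarrow> unipolar ar (Disj A B) \<longrightarrow> derivable ar (Disj A B) \<longrightarrow>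
            derivable ar A \<or> derivable ar B) \<and>
         (\<forall>x A. is_formula ar (Exists x A) \<longrightarrow> unipolar ar (Exists x A) \<longrightarrow> derivable ar (Exists x A) \<longrightarrow>
            (\<exists>t. derivable ar (subst A x t)))"
proof (intro conjI allI impI)
  fix A B
  assume form: "is_formula ar (Disj A B)" and "unipolar ar (Disj A B)"
    and der: "derivable ar (Disj A B)"
  then obtain v where v: "\<And>p s. occurs (Disj A B) s (Atom p []) \<Longrightarrow> v p = (\<not> s)"
    using unipolar_valuation by blast
  have "slash ar v id (Disj A B)"
    using slash_sound[of ar "[]" _ v id] der by (fastforce simp: derivable_def simp del: slash.simps)
  then have "slash ar v id A \<or> slash ar v id B" by simp
  then have "derivable ar (ssubst id A) \<or> derivable ar (ssubst id B)"
    using form v occurs_sub(3,4) derivable_if_slash[of ar _ v id]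
    by (metis is_formula.simps(5))
  then show "derivable ar A \<or> derivable ar B" by (simp add: ssubst_id)
next
  fix x A
  assume form: "is_formula ar (Exists x A)" and "unipolar ar (Exists x A)"
    and der: "derivable ar (Exists x A)"
  then obtain v where v: "\<And>p s. occurs (Exists x A) s (Atom p []) \<Longrightarrow> v p = (\<not> s)"
    using unipolar_valuation by blast
  have "slash ar v id (Exists x A)"
    using slash_sound[of ar "[]" _ v id] der by (fastforce simp: derivable_def simp del: slash.simps)
  then obtain t where "slash ar v (id(x := t)) A" by auto
  then have "derivable ar (ssubst (id(x := t)) A)"
    using form v by (intro derivable_if_slash[of ar A v]) (auto dest!: occurs_sub(9)[of A _ _ x])
  then show "\<exists>t. derivable ar (subst A x t)" unfolding subst_def by blast
qed

end
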